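(* For each non-negative integer $N$, $$rT(1,1,1;N)=\begin{cases}Rt(2,2,2;N)&\text{if }N\equiv0\pmod2,\\4\,T(2,4,4;N-1)&\text{if }N\equiv1\pmod2.\end{cases}$$
   Context: $\mathbb{N}_0=\{0,1,2,\dots\}$ and $t_n=n(n+1)/2$ (triangular numbers). For positive integers $a_1,a_2,a_3$ and $N\in\mathbb{N}_0$: $rT(a_1,a_2,a_3;N)=|\{(l,m,n)\in\mathbb{Z}\times\mathbb{N}_0^2: N=a_1l^2+a_2t_m+a_3t_n\}|$; $Rt(a_1,a_2,a_3;N)=|\{(l,m,n)\in\mathbb{Z}^2\times\mathbb{N}_0: N=a_1l^2+a_2m^2+a_3t_n\}|$; $T(a_1,a_2,a_3;N)=|\{(l,m,n)\in\mathbb{N}_0^3: N=a_1t_l+a_2t_m+a_3t_n\}|$. *)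

theory Defs
  imports Complex_Main
begin

definition triangular :: "nat \<Rightarrow> nat" where
  "triangular n = n * (n + 1) div 2"

text \<open>
  The three representation counts. They are meant for positive coefficients a1, a2, a3; the sets
  are then finite, so that \<^const>\<open>card\<close> is the actual number of representations (for a zero
  coefficient the set may be infinite and \<^const>\<open>card\<close> is 0). Variables ranging over the integers
  have type \<^typ>\<open>int\<close>, those ranging over the non-negative integers have type \<^typ>\<open>nat\<close>; where both
  occur, the equation is stated over the integers.
\<close>

definition rT :: "nat \<Rightarrow> nat \<Rightarrow> nat \<Rightarrow> nat \<Rightarrow> nat" where
  "rT a1 a2 a3 N = card {(l::int, m::nat, n::nat).
     int N = int a1 * l\<^sup>2 + int a2 * int (triangular m) + int a3 * int (triangular n)}"

definition Rt :: "nat \<Rightarrow> nat \<Rightarrow> nat \<Rightarrow> nat \<Rightarrow> nat" where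
  "Rt a1 a2 a3 N = card {(l::int, m::int, n::nat).
     int N = int a1 * l\<^sup>2 + int a2 * m\<^sup>2 + int a3 * int (triangular n)}"

definition T :: "nat \<Rightarrow> nat \<Rightarrow> nat \<Rightarrow> nat \<Rightarrow> nat" where
  "T a1 a2 a3 N = card {(l::nat, m::nat, n::nat).
     N = a1 * triangular l + a2 * triangular m + a3 * triangular n}"

end

theory Submission
  imports Defs
begin

text \<open>
  Extend \<open>t\<close> to the integers by \<open>t\<^bsub>k\<^esub> = k(k + 1)/2\<close>, so that \<open>t\<^bsub>-k-1\<^esub> = t\<^bsub>k\<^esub>\<close>.
  Since \<open>t\<^bsub>y+x\<^esub> + t\<^bsub>y-x\<^esub> = x\<^sup>2 + 2 t\<^bsub>y\<^esub>\<close>, sums of two triangular numbers are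
  equinumerous with sums \<open>x\<^sup>2 + 2 t\<^bsub>y\<^esub>\<close> (Ramanujan's \<open>\<psi>(q)\<^sup>2 = \<phi>(q) \<psi>(q\<^sup>2)\<close>), so it
  suffices to count \<open>N = l\<^sup>2 + x\<^sup>2 + 2 t\<^bsub>y\<^esub>\<close>. For even \<open>N\<close> put \<open>l = u + v\<close>, \<open>x = u - v\<close>;
  for odd \<open>N\<close> put \<open>l = u + v + 1\<close>, \<open>x = u - v\<close>, whence \<open>l\<^sup>2 + x\<^sup>2 = 4 t\<^bsub>u\<^esub> + 4 t\<^bsub>v\<^esub> + 1\<close>,
  and each of the integer indices \<open>u\<close>, \<open>v\<close> accounts for a factor 2.
\<close>

lemma two_triangular: "2 * int (triangular n) = int n * (int n + 1)"
proof -
  have "2 * triangular n = n * (n + 1)"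
    by (simp add: triangular_def)
  then have "int (2 * triangular n) = int (n * (n + 1))"
    by (rule arg_cong)
  then show ?thesis
    by (simp add: algebra_simps)
qed

text \<open>Folds the integers two-to-one onto the naturals along the reflection \<open>k\<close> to
  \<open>- k - 1\<close>, the symmetry of \<open>k * (k + 1)\<close>.\<close>

definition tri_index :: "int \<Rightarrow> nat" where
  "tri_index k = nat (if 0 \<le> k then k else - k - 1)"

lemma int_tri_index: "int (tri_index k) = (if 0 \<le> k then k else - k - 1)"
  by (simp add: tri_index_def)

lemma tri_index_eq_iff: "tri_index j = tri_index k \<longleftrightarrow> j = k \<or> j + k = - 1"
  by (auto simp: tri_index_def)

lemma two_triangular_index: "2 * int (triangular (tri_index k)) = k * (k + 1)"
  unfolding two_triangular int_tri_index by (simp add: algebra_simps)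

lemma triangular_index_add_diff:
  "int (triangular (tri_index (int y + x))) + int (triangular (tri_index (int y - x)))
     = x\<^sup>2 + 2 * int (triangular y)"
proof -
  have "2 * (int (triangular (tri_index (int y + x))) + int (triangular (tri_index (int y - x))))
      = 2 * (x\<^sup>2 + 2 * int (triangular y))"
    unfolding distrib_left two_triangular_index
    using two_triangular[of y] by (simp add: algebra_simps power2_eq_square)
  then show ?thesis
    by simp
qed

lemma bij_tri_index_add_diff:
  "bij (\<lambda>(x::int, y::nat). (tri_index (int y + x), tri_index (int y - x)))" (is "bij ?f")
proof (rule bijI)
  show "inj ?f"
  proof (rule injI, clarify)
    fix x x' :: int and y y' :: nat
    assume "tri_index (int y + x) = tri_index (int y' + x')"
      and "tri_index (int y - x) = tri_index (int y' - x')"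
    then have "int y + x = int y' + x' \<or> int y + x + (int y' + x') = - 1"
      and "int y - x = int y' - x' \<or> int y - x + (int y' - x') = - 1"
      unfolding tri_index_eq_iff by blast+
    \<comment> \<open>If just one index is reflected, an even number would equal -1; if both are,
      adding the two equations gives \<open>y + y' = - 1\<close>, impossible for naturals.\<close>
    moreover have "2 * (int y - x') \<noteq> - 1" "2 * (int y + x') \<noteq> - 1"
      by presburger+
    ultimately have "int y + x = int y' + x'" "int y - x = int y' - x'"
      by (auto simp: algebra_simps)
    then show "x = x' \<and> y = y'"
      by simp
  qed
  have ex: "\<exists>x y. (m, n) = ?f (x, y)" for m n
  proof -
    \<comment> \<open>Solve \<open>y + x = m\<close>, \<open>y - x = n\<close> when
      \<open>m - n\<close> is even. Otherwise the smaller of \<open>m\<close>, \<open>n\<close> is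
      first reflected, which restores the parity; \<open>0 \<le> k\<close> then makes
      \<open>y = k\<close> a natural number.\<close>
    consider k where "int m - int n = 2 * k"
      | k where "int m - int n = 2 * k + 1" "0 \<le> k"
      | k where "int n - int m = 2 * k + 1" "0 \<le> k"
    proof (cases "even (int m - int n)")
      case False
      then obtain k where k: "int m - int n = 2 * k + 1"
        by (rule oddE)
      show thesis
      proof (cases "0 \<le> k")
        case True
        with k show thesis
          by (rule that(2))
      next
        case False
        with k show thesis
          by (intro that(3)[of "- k - 1"]) simp_all
      qed
    qed blast
    then show ?thesis
    proof cases
      case 1
      then have "(m, n) = ?f (k, nat (int n + k))"
        by (simp add: tri_index_def)
      then show ?thesis by (intro exI)
    next
      case 2
      then have "(m, n) = ?f (int n + k + 1, nat k)"
        by (simp add: tri_index_def)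
      then show ?thesis by (intro exI)
    next
      case 3
      then have "(m, n) = ?f (- (int m + k + 1), nat k)"
        by (simp add: tri_index_def)
      then show ?thesis by (intro exI)
    qed
  qed
  show "surj ?f"
    unfolding surj_def split_paired_All split_paired_Ex by (intro allI ex)
qed

lemma rT_111_eq_card:
  "rT 1 1 1 N = card {(l::int, x::int, y::nat). int N = l\<^sup>2 + x\<^sup>2 + 2 * int (triangular y)}"
    (is "_ = card ?S")
proof -
  let ?f = "\<lambda>(x::int, y::nat). (tri_index (int y + x), tri_index (int y - x))"
  let ?R = "{(l::int, m, n). int N = l\<^sup>2 + int (triangular m) + int (triangular n)}"
  have bij: "bij (map_prod (id :: int \<Rightarrow> int) ?f)"
    using bij_betw_map_prod[OF bij_id bij_tri_index_add_diff] by simp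
  moreover have "map_prod id ?f -` ?R = ?S"
    using triangular_index_add_diff by (auto simp: add.assoc)
  ultimately have "card ?R = card ?S"
    using card_vimage_inj[OF bij_is_inj[OF bij], of ?R] bij_is_surj[OF bij] by simp
  then show ?thesis
    by (simp add: rT_def)
qed

text \<open>Evenness of \<open>N\<close> forces \<open>l\<close> and \<open>x\<close> to have equal
  parity, exactly the condition for \<open>(l, x)\<close> to be of the form
  \<open>(u + v, u - v)\<close>.\<close>

lemma card_even_case:
  assumes "even N"
  shows "card {(l::int, x::int, y::nat). int N = l\<^sup>2 + x\<^sup>2 + 2 * int (triangular y)} = Rt 2 2 2 N"
    (is "card ?S = _")
proof -
  let ?R = "{(u::int, v::int, y::nat). int N = 2 * u\<^sup>2 + 2 * v\<^sup>2 + 2 * int (triangular y)}"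
  let ?f = "\<lambda>(u::int, v::int, y::nat). (u + v, u - v, y)"
  have "bij_betw ?f ?R ?S"
    unfolding bij_betw_def
  proof (intro conjI subset_antisym subsetI)
    show "inj_on ?f ?R"
      by (auto simp: inj_on_def)
    fix p assume "p \<in> ?f ` ?R"
    then show "p \<in> ?S"
      by (auto simp: power2_eq_square algebra_simps)
  next
    fix p assume "p \<in> ?S"
    then obtain l x y where p: "p = (l, x, y)"
      and N: "int N = l\<^sup>2 + x\<^sup>2 + 2 * int (triangular y)"
      by auto
    have "even (int N)"
      using assms by simp
    then have "even (l + x)"
      unfolding N by simp
    then obtain u where "l + x = 2 * u"
      by blast
    then have l: "l = u + (l - u)" and x: "x = u - (l - u)"
      by simp_all
    have "(u, l - u, y) \<in> ?R"
      \<comment> \<open>With \<open>v = l - u\<close> only \<open>x = 2 * u - l\<close> needs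
        eliminating.\<close>
      using N by (subst (asm) x) (simp add: power2_eq_square algebra_simps)
    moreover have "p = ?f (u, l - u, y)"
      using p l x by simp
    ultimately show "p \<in> ?f ` ?R"
      by (rule rev_image_eqI)
  qed
  then show ?thesis
    by (simp add: Rt_def bij_betw_same_card)
qed

lemma square_add_square_opposite_parity:
  "(u + v + 1)\<^sup>2 + (u - v)\<^sup>2
     = 4 * int (triangular (tri_index u)) + 4 * int (triangular (tri_index v)) + 1"
  using two_triangular_index[of u] two_triangular_index[of v]
  by (simp add: power2_eq_square algebra_simps)

text \<open>Now \<open>l\<close> and \<open>x\<close> have opposite parity, so the shift by 1 in
  \<open>l = u + v + 1\<close> is needed to reach every solution.\<close>

lemma card_odd_case:
  assumes "odd N"
  shows "card {(l::int, x::int, y::nat). int N = l\<^sup>2 + x\<^sup>2 + 2 * int (triangular y)}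
    = card {(u::int, v::int, y::nat).
        N - 1 = 2 * triangular y + 4 * triangular (tri_index u) + 4 * triangular (tri_index v)}"
    (is "card ?S = card ?R")
proof -
  let ?f = "\<lambda>(u::int, v::int, y::nat). (u + v + 1, u - v, y)"
  \<comment> \<open>An odd \<open>N\<close> is positive, so the truncated subtraction
    \<open>N - 1\<close> is exact.\<close>
  have mem: "?f (u, v, y) \<in> ?S \<longleftrightarrow> (u, v, y) \<in> ?R" for u v y
    using assms odd_pos[OF assms] square_add_square_opposite_parity[of u v] by auto
  have "bij_betw ?f ?R ?S"
    unfolding bij_betw_def
  proof (intro conjI subset_antisym subsetI)
    show "inj_on ?f ?R"
      by (auto simp: inj_on_def)
    fix p assume "p \<in> ?f ` ?R"
    then show "p \<in> ?S"
      using mem by (elim imageE) (simp only: split_paired_all)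
  next
    fix p assume S: "p \<in> ?S"
    then obtain l x y where p: "p = (l, x, y)"
      and N: "int N = l\<^sup>2 + x\<^sup>2 + 2 * int (triangular y)"
      by auto
    have "odd (int N)"
      using assms by simp
    then have "odd (l + x)"
      unfolding N by simp
    then obtain u where "l + x = 2 * u + 1"
      by (rule oddE)
    then have pf: "p = ?f (u, l - u - 1, y)"
      using p by simp
    with S have "(u, l - u - 1, y) \<in> ?R"
      using mem by (simp only:)
    then show "p \<in> ?f ` ?R"
      using pf by (rule rev_image_eqI)
  qed
  then show ?thesis
    by (simp add: bij_betw_same_card)
qed

text \<open>Every natural index has exactly two preimages under \<open>tri_index\<close>, told apart
  by sign; two Booleans record the signs of \<open>u\<close> and \<open>v\<close>, giving the factor
  4.\<close>

lemma card_tri_index_eq_T: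
  "card {(u::int, v::int, y::nat).
      M = a * triangular y + b * triangular (tri_index u) + c * triangular (tri_index v)}
    = 4 * T a b c M"
    (is "card ?S = _")
proof -
  let ?R = "{(y, m, n). M = a * triangular y + b * triangular m + c * triangular n}"
  let ?e = "\<lambda>s n. if s then int n else - int n - 1"
  let ?f = "\<lambda>((s, t), (y, m, n)). (?e s m, ?e t n, y)"
  let ?g = "\<lambda>(u, v, y). ((0 \<le> u, 0 \<le> v), (y, tri_index u, tri_index v))"
  have "bij_betw ?f (UNIV \<times> ?R) ?S"
    by (rule bij_betw_byWitness[where f' = ?g]) (auto simp: tri_index_def)
  then have "card ?S = card ((UNIV :: (bool \<times> bool) set) \<times> ?R)"
    by (simp add: bij_betw_same_card)
  then show ?thesis
    by (simp add: card_cartesian_product T_def flip: UNIV_Times_UNIV)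
qed

theorem theorem5p1:
  fixes N :: nat
  shows "(N mod 2 = 0 \<longrightarrow> rT 1 1 1 N = Rt 2 2 2 N) \<and>
         (N mod 2 = 1 \<longrightarrow> rT 1 1 1 N = 4 * T 2 4 4 (N - 1))"
proof (intro conjI impI)
  assume "N mod 2 = 0"
  then show "rT 1 1 1 N = Rt 2 2 2 N"
    unfolding rT_111_eq_card by (intro card_even_case) presburger
next
  assume "N mod 2 = 1"
  then have "odd N"
    by presburger
  then show "rT 1 1 1 N = 4 * T 2 4 4 (N - 1)"
    unfolding rT_111_eq_card card_odd_case[OF \<open>odd N\<close>] by (intro card_tri_index_eq_T)
qed

end
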